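(* Let $n$ be an integer with $n\geq 13$. If $n\equiv 0,1,4\pmod 6$, then $\gamma^{LD}(C_n(1,3))=\lceil n/3\rceil$, and otherwise $\gamma^{LD}(C_n(1,3))=\lceil n/3\rceil+1$.
   Context: For a positive integer $n$, the circulant graph $C_n(1,3)$ has vertex set $\mathbb{Z}_n$, and $u$ is adjacent to $u\pm1$ and $u\pm 3$ (modulo $n$); $N[u]=\{u,u\pm1,u\pm3\}$. For a code (nonempty subset) $C\subseteq\mathbb{Z}_n$, $I(C;u)=N[u]\cap C$. $C$ is locating-dominating if $I(C;u)\neq\emptyset$ for all vertices $u$ and $I(C;u)\neq I(C;v)$ for all distinct $u,v\in\mathbb{Z}_n\setminus C$. $\gamma^{LD}(G)$ is the minimum cardinality of a locating-dominating code in $G$. *)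

theory Defs
  imports Complex_Main
begin

text \<open>A graph is given by a vertex set \<open>V\<close> and an adjacency relation \<open>adj\<close> on it.\<close>

definition closed_nbhd :: "'a set \<Rightarrow> ('a \<Rightarrow> 'a \<Rightarrow> bool) \<Rightarrow> 'a \<Rightarrow> 'a set" where
  "closed_nbhd V adj u = {v \<in> V. v = u \<or> adj u v}"

definition I_set :: "'a set \<Rightarrow> ('a \<Rightarrow> 'a \<Rightarrow> bool) \<Rightarrow> 'a set \<Rightarrow> 'a \<Rightarrow> 'a set" where
  "I_set V adj C u = closed_nbhd V adj u \<inter> C"

definition locating_dominating :: "'a set \<Rightarrow> ('a \<Rightarrow> 'a \<Rightarrow> bool) \<Rightarrow> 'a set \<Rightarrow> bool" where
  "locating_dominating V adj C \<longleftrightarrow>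
     C \<subseteq> V \<and> C \<noteq> {} \<and>
     (\<forall>u\<in>V. I_set V adj C u \<noteq> {}) \<and>
     (\<forall>u\<in>V - C. \<forall>v\<in>V - C. u \<noteq> v \<longrightarrow> I_set V adj C u \<noteq> I_set V adj C v)"

text \<open>For finite nonempty \<open>V\<close> the whole vertex set is a locating-dominating code,
  so the minimum below is attained.\<close>

definition gamma_LD :: "'a set \<Rightarrow> ('a \<Rightarrow> 'a \<Rightarrow> bool) \<Rightarrow> nat" where
  "gamma_LD V adj = (LEAST k. \<exists>C. locating_dominating V adj C \<and> card C = k)"

text \<open>The circulant graph \<open>C\<^sub>n(D)\<close>; the ring of integers modulo \<open>n\<close> is
  represented by the residues \<open>0, \<dots>, n - 1\<close>.\<close>

definition circulant_verts :: "nat \<Rightarrow> int set" where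
  "circulant_verts n = {0..<int n}"

definition circulant_adj :: "nat \<Rightarrow> int set \<Rightarrow> int \<Rightarrow> int \<Rightarrow> bool" where
  "circulant_adj n D u v \<longleftrightarrow>
     u \<in> circulant_verts n \<and> v \<in> circulant_verts n \<and>
     (\<exists>d\<in>D. v = (u + d) mod int n \<or> v = (u - d) mod int n)"

end

(*
Read a code C as an n-periodic 0/1 sequence x. Two vertices with a common neighbour
differ by 2, 4 or 6, so C is locating-dominating iff x satisfies local conditions on
windows of 13 consecutive letters.

Lower bound: put W = 3|C| - n, the sum of 3 x(i) - 1 over one period. A potential on windows of ten
letters shows W >= 0, and W >= 2 as soon as x passes from a window that is not a factor of the
periodic word (110000)(110000)... (a "core" window) to one that is. A second potential gives
12 W >= n, hence W >= 2, if there is no core window at all. If all windows are core, x has period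
exactly 6 and 6 divides n. So W >= 2 unless 6 divides n, which is the bound claimed.

Upper bound: the words (110000)^m t with a tail t depending on n mod 6.
*)
theory Submission
  imports Defs
begin

section \<open>Local conditions on a two-sided sequence\<close>

definition offsets :: "int set" where
  "offsets = {-3, -1, 0, 1, 3}"

definition dominated :: "(int \<Rightarrow> bool) \<Rightarrow> int \<Rightarrow> bool" where
  "dominated x i \<longleftrightarrow> (\<exists>a\<in>offsets. x (i + a))"

text \<open>For non-codewords \<open>i\<close> and \<open>i + d\<close>: some codeword lies in exactly one of the two
  neighbourhoods.\<close>

definition separated :: "(int \<Rightarrow> bool) \<Rightarrow> int \<Rightarrow> int \<Rightarrow> bool" where
  "separated x d i \<longleftrightarrow> x i \<or> x (i + d) \<or>
     (\<exists>a\<in>offsets. x (i + a) \<and> a - d \<notin> offsets) \<or>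
     (\<exists>a\<in>offsets. x (i + d + a) \<and> a + d \<notin> offsets)"

subsection \<open>Locating-dominating codes as periodic sequences\<close>

lemma mod_eq_small_diff:
  fixes u v :: int
  assumes "u mod int n = v mod int n" "\<bar>u - v\<bar> < int n"
  shows "u = v"
proof -
  have "int n dvd u - v" using assms(1) by (simp add: mod_eq_dvd_iff)
  then show ?thesis using assms(2) dvd_imp_le_int[of "u - v" "int n"] by fastforce
qed

text \<open>Letting \<open>u\<close> be any integer, reduced only afterwards, turns a cyclic
  neighbourhood into positions of the sequence around \<open>u\<close>, so wrap-around needs no case
  distinction.\<close>

lemma I_set_circulant:
  assumes "C \<subseteq> circulant_verts n" "n > 0"
  shows "I_set (circulant_verts n) (circulant_adj n {1, 3}) C (u mod int n) =
         (\<lambda>a. (u + a) mod int n) ` {a \<in> offsets. (u + a) mod int n \<in> C}"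
proof -
  have adj: "circulant_adj n {1, 3} (u mod int n) v \<longleftrightarrow>
      (\<exists>a\<in>{-3, -1, 1, 3}. v = (u + a) mod int n)" for v
    using assms(2)
    by (auto simp: circulant_adj_def circulant_verts_def mod_add_left_eq mod_diff_left_eq)
  have "v \<in> closed_nbhd (circulant_verts n) (circulant_adj n {1, 3}) (u mod int n) \<longleftrightarrow>
      (\<exists>a\<in>offsets. v = (u + a) mod int n)" for v
    using assms(2) unfolding closed_nbhd_def mem_Collect_eq adj
    by (auto simp: offsets_def circulant_verts_def)
  then have "closed_nbhd (circulant_verts n) (circulant_adj n {1, 3}) (u mod int n) =
      (\<lambda>a. (u + a) mod int n) ` offsets"
    by (simp add: set_eq_iff image_iff)
  then show ?thesis by (auto simp: I_set_def)
qed

text \<open>Non-codewords \<open>u\<close>, \<open>v\<close> whose sets meet satisfy u + a = v + b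
  modulo n with nonzero, hence odd, offsets, so up to order they differ by 2, 4 or 6 modulo n. All
  other pairs have disjoint nonempty sets, and domination alone tells them apart.\<close>

lemma locating_dominating_iff:
  fixes C :: "int set" and n :: nat
  defines "x \<equiv> \<lambda>i. i mod int n \<in> C"
  assumes "n \<ge> 13" "C \<subseteq> circulant_verts n" "C \<noteq> {}"
  shows "locating_dominating (circulant_verts n) (circulant_adj n {1, 3}) C \<longleftrightarrow>
         (\<forall>i. dominated x i \<and> (\<forall>d\<in>{2, 4, 6}. separated x d i))"
    (is "?L \<longleftrightarrow> ?R")
proof -
  define J where "J u = I_set (circulant_verts n) (circulant_adj n {1, 3}) C (u mod int n)" for u
  have V: "u mod int n \<in> circulant_verts n" for u
    using assms(2) by (simp add: circulant_verts_def)
  have V': "u mod int n = u" if "u \<in> circulant_verts n" for u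
    using that by (simp add: circulant_verts_def)
  have J: "J u = (\<lambda>a. (u + a) mod int n) ` {a \<in> offsets. x (u + a)}" for u
    using I_set_circulant[OF assms(3), of u] assms(2) by (simp add: J_def x_def)
  have dom: "J u \<noteq> {} \<longleftrightarrow> dominated x u" for u
    by (auto simp: J dominated_def)
  have sep: "J u \<noteq> J (u + d) \<longleftrightarrow> separated x d u"
    if "d \<in> {2, 4, 6}" "\<not> x u" "\<not> x (u + d)" for u d
  proof
    assume s: "separated x d u"
    \<comment> \<open>The two positions differ by at most 3 + 3 + 6 = 12 < n, so congruence forces
      equality. This is where 13 comes from.\<close>
    have bnd: "u + a = u + d + b" if "(u + a) mod int n = (u + d + b) mod int n"
      "a \<in> offsets" "b \<in> offsets" for a b
    proof (rule mod_eq_small_diff[OF that(1)])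
      have "\<bar>a\<bar> \<le> 3" "\<bar>b\<bar> \<le> 3" using that(2,3) by (auto simp: offsets_def)
      moreover have "0 < d" "d \<le> 6" using \<open>d \<in> {2, 4, 6}\<close> by auto
      ultimately show "\<bar>u + a - (u + d + b)\<bar> < int n" using \<open>n \<ge> 13\<close> by linarith
    qed
    have "(\<exists>a\<in>offsets. x (u + a) \<and> a - d \<notin> offsets) \<or>
          (\<exists>a\<in>offsets. x (u + d + a) \<and> a + d \<notin> offsets)"
      using s that by (simp add: separated_def)
    then show "J u \<noteq> J (u + d)"
    proof (elim disjE bexE conjE)
      fix a assume a: "a \<in> offsets" "x (u + a)" "a - d \<notin> offsets"
      then have "(u + a) mod int n \<in> J u" by (auto simp: J)
      moreover have "(u + a) mod int n \<notin> J (u + d)"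
      proof
        assume "(u + a) mod int n \<in> J (u + d)"
        then obtain b where "b \<in> offsets" "(u + a) mod int n = (u + d + b) mod int n"
          by (auto simp: J)
        with bnd[of a b] a have "a - d = b" by simp
        then show False using a \<open>b \<in> offsets\<close> by simp
      qed
      ultimately show ?thesis by blast
    next
      fix a assume a: "a \<in> offsets" "x (u + d + a)" "a + d \<notin> offsets"
      then have "(u + d + a) mod int n \<in> J (u + d)" by (auto simp: J)
      moreover have "(u + d + a) mod int n \<notin> J u"
      proof
        assume "(u + d + a) mod int n \<in> J u"
        then obtain b where "b \<in> offsets" "(u + b) mod int n = (u + d + a) mod int n"
          by (auto simp: J)
        with bnd[of b a] a have "a + d = b" by simp
        then show False using a \<open>b \<in> offsets\<close> by simp
      qed
      ultimately show ?thesis by blast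
    qed
  next
    assume ne: "J u \<noteq> J (u + d)"
    show "separated x d u"
    proof (rule ccontr)
      assume ns: "\<not> separated x d u"
      have "J u \<subseteq> J (u + d)"
      proof
        fix z assume "z \<in> J u"
        then obtain a where a: "a \<in> offsets" "x (u + a)" "z = (u + a) mod int n"
          by (auto simp: J)
        then have "a - d \<in> offsets" using ns by (auto simp: separated_def)
        then show "z \<in> J (u + d)"
          using a unfolding J by (intro image_eqI[of _ _ "a - d"]) auto
      qed
      moreover have "J (u + d) \<subseteq> J u"
      proof
        fix z assume "z \<in> J (u + d)"
        then obtain a where a: "a \<in> offsets" "x (u + d + a)" "z = (u + d + a) mod int n"
          by (auto simp: J)
        then have "a + d \<in> offsets" using ns by (auto simp: separated_def)
        then show "z \<in> J u"
          using a unfolding J by (intro image_eqI[of _ _ "a + d"]) (auto simp: algebra_simps)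
      qed
      ultimately show False using ne by blast
    qed
  qed
  show ?thesis
  proof
    assume L: ?L
    show ?R
    proof (intro allI conjI ballI)
      fix i show "dominated x i"
        using L V[of i] dom[of i] by (simp add: locating_dominating_def J_def)
    next
      fix i d :: int assume d: "d \<in> {2, 4, 6}"
      show "separated x d i"
      proof (cases "x i \<or> x (i + d)")
        case False
        have "i mod int n \<noteq> (i + d) mod int n"
          using mod_eq_small_diff[of i n "i + d"] d \<open>n \<ge> 13\<close> by auto
        then have "J i \<noteq> J (i + d)"
          using L V[of i] V[of "i + d"] False
          by (auto simp: locating_dominating_def J_def x_def)
        then show ?thesis using sep[OF d] False by simp
      qed (auto simp: separated_def)
    qed
  next
    assume R: ?R
    have shift: "J u \<noteq> J v"
      if "v mod int n = (u + d) mod int n" "d \<in> {2, 4, 6}" "\<not> x u" "\<not> x v" for u v d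
    proof -
      have "J v = J (u + d)" "x v = x (u + d)"
        using that(1) by (simp_all add: J_def x_def)
      then show ?thesis using sep[of d u] that R by auto
    qed
    have ne: "J u \<noteq> J v"
      if uv: "u \<in> circulant_verts n - C" "v \<in> circulant_verts n - C" "u \<noteq> v" for u v
    proof
      assume eq: "J u = J v"
      have nx: "\<not> x u" "\<not> x v" using uv V' by (auto simp: x_def)
      have "J u \<noteq> {}" using dom R by blast
      then obtain z where "z \<in> J u" "z \<in> J v" using eq by blast
      then obtain a b where ab: "a \<in> offsets" "b \<in> offsets" "x (u + a)" "x (v + b)"
        and "(u + a) mod int n = (v + b) mod int n"
        unfolding J by blast
      then have dv: "int n dvd u + a - (v + b)" by (simp add: mod_eq_dvd_iff)
      have m1: "v mod int n = (u + (a - b)) mod int n"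
        using dv by (simp add: mod_eq_dvd_iff algebra_simps dvd_diff_commute)
      have m2: "u mod int n = (v + (b - a)) mod int n"
        using dv by (simp add: mod_eq_dvd_iff algebra_simps)
      \<comment> \<open>A zero offset would make \<open>u\<close> or \<open>v\<close> a codeword;
        the remaining offsets are odd, so their differences are even.\<close>
      have "a \<noteq> 0" "b \<noteq> 0" using ab nx by auto
      moreover have "a \<noteq> b" using m1 V' uv by auto
      ultimately have "a - b \<in> {2, 4, 6} \<or> b - a \<in> {2, 4, 6}"
        using ab by (auto simp: offsets_def)
      then show False
        using shift[OF m1] shift[OF m2] nx eq by auto
    qed
    have "I_set (circulant_verts n) (circulant_adj n {1, 3}) C u \<noteq>
        I_set (circulant_verts n) (circulant_adj n {1, 3}) C v"
      if "u \<in> circulant_verts n - C" "v \<in> circulant_verts n - C" "u \<noteq> v" for u v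
      using ne[OF that] that V'[of u] V'[of v] by (simp add: J_def)
    moreover have "I_set (circulant_verts n) (circulant_adj n {1, 3}) C u \<noteq> {}"
      if "u \<in> circulant_verts n" for u
      using that V'[of u] dom[of u] R by (simp add: J_def)
    ultimately show ?L
      using assms(3,4) by (simp add: locating_dominating_def)
  qed
qed

subsection \<open>Lower bound\<close>

definition core :: "(int \<Rightarrow> bool) \<Rightarrow> bool" where
  "core y \<longleftrightarrow> (\<exists>s\<in>{0, 1, 2, 3, 4, 5}. \<forall>j\<in>{0, 1, 2, 3, 4, 5, 6, 7, 8, 9}. y j \<longleftrightarrow> (s + j) mod 6 < 2)"

text \<open>The two potentials were found by computer: they are shortest-path distances in a quotient
  of the graph whose edges are the admissible words of length 11.\<close>

definition potA :: "(int \<Rightarrow> bool) \<Rightarrow> int" where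
  "potA y =
    (if y 2
      then (if y 1
         then (if y 0 then 6 else (if y 4 then 5 else (if y 7 then 5 else (if y 5 then 5 else 4))))
         else (if y 0
            then (if y 6 then 5 else (if y 3 then 5 else 4))
            else (if y 3
               then (if y 6 then 4 else (if y 5 then 4 else (if y 8 then 4 else 3)))
               else (if y 4 then 3 else 2))))
      else (if y 1
         then (if y 4
            then (if y 0 then 6 else (if y 3 then 4 else 3))
            else (if y 3
               then (if y 0 then 6 else (if y 7 then 4 else 3))
               else (if y 0
                  then (if y 6 then (if y 7 then 6 else 4) else (if y 7 then 5 else 4))
                  else (if y 5 then 3 else (if y 7 then 3 else 2)))))
         else (if y 0
            then (if y 3
               then 4
               else (if y 4
                  then (if y 5
                     then (if y 7 then 5 else (if y 6 then 4 else (if y 9 then 4 else 3)))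
                     else 3)
                  else (if y 5
                     then (if y 6 then 4 else (if y 7 then 3 else 2))
                     else (if y 6 then 3 else 2))))
            else (if y 4
               then (if y 3
                  then (if y 6 then 3 else (if y 7 then 3 else (if y 9 then 3 else 2)))
                  else (if y 5 then 2 else (if y 6 then 1 else 0)))
               else (if y 3 then (if y 5 then 2 else 1) else (if y 5 then 1 else 0))))))"

definition potB :: "(int \<Rightarrow> bool) \<Rightarrow> int" where
  "potB y =
    (if y 2
      then (if y 1
         then (if y 0
            then (if y 3 then 78 else (if y 4 then 78 else (if y 6 then 78 else 69)))
            else (if y 3
               then (if y 4 then 65 else (if y 7 then 65 else (if y 5 then 65 else 56)))
               else (if y 5
                  then (if y 4 then 65 else (if y 6 then 64 else 56))
                  else (if y 4 then 65 else (if y 6 then (if y 7 then 63 else 53) else 44)))))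
         else (if y 0
            then (if y 4 then (if y 6 then 78 else (if y 3 then 78 else 69)) else 59)
            else (if y 3
               then (if y 4
                  then (if y 6 then 52 else (if y 5 then 52 else (if y 8 then 52 else 43)))
                  else (if y 5
                     then 52
                     else (if y 6
                        then (if y 7 then 51 else 43)
                        else (if y 7 then (if y 8 then 50 else 40) else 31))))
               else (if y 4 then (if y 6 then 52 else 33) else (if y 6 then 27 else 23)))))
      else (if y 1
         then (if y 3
            then (if y 0
               then 78
               else (if y 4
                  then (if y 5 then 65 else 46)
                  else (if y 5 then (if y 7 then 65 else 56) else 46)))
            else (if y 4
               then (if y 0 then (if y 5 then 77 else 69) else (if y 5 then 41 else 37))
               else (if y 0
                  then (if y 5
                     then (if y 6 then (if y 7 then 76 else 64) else (if y 7 then 66 else 56))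
                     else (if y 7 then 57 else 46))
                  else (if y 5 then (if y 7 then 40 else 37) else 36))))
         else (if y 0
            then (if y 3
               then (if y 4 then 54 else (if y 7 then 50 else 46))
               else (if y 4
                  then (if y 5
                     then (if y 6 then 53 else (if y 7 then 62 else (if y 9 then 50 else 41)))
                     else (if y 6 then 43 else 33))
                  else (if y 5
                     then (if y 7 then 49 else (if y 6 then 40 else 24))
                     else (if y 6 then 34 else 23))))
            else (if y 3
               then (if y 4
                  then (if y 5
                     then (if y 6 then 39 else (if y 7 then 39 else (if y 9 then 39 else 30)))
                     else (if y 6
                        then 39
                        else (if y 7
                           then (if y 8 then 38 else 30)
                           else (if y 8 then (if y 9 then 37 else 27) else 18))))
                  else (if y 5 then (if y 7 then 39 else 20) else (if y 7 then 14 else 10)))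
               else (if y 4
                  then (if y 5
                     then (if y 6 then 26 else (if y 7 then 26 else (if y 9 then 24 else 17)))
                     else (if y 6 then 26 else 1))
                  else (if y 5 then (if y 7 then 13 else 11) else 0))))))"

text \<open>Passing from one window of ten letters to the next involves letters 0 to 10; these are
  exactly the instances of the local conditions that read no other letters.\<close>

definition admissible :: "(int \<Rightarrow> bool) \<Rightarrow> bool" where
  "admissible y \<longleftrightarrow> (\<forall>i\<in>{3, 4, 5, 6, 7}. dominated y i) \<and>
     (\<forall>i\<in>{3, 4, 5}. separated y 2 i) \<and> separated y 4 3"

text \<open>Common neighbours cancel: a separation clause keeps the two centres and the letters seen
  from only one of them. In this form the hypotheses of the potential inequalities are plain Boolean
  clauses.\<close>

lemma admissible_clauses:
  assumes "admissible y"
  shows "y 0 \<or> y 2 \<or> y 3 \<or> y 4 \<or> y 6" "y 1 \<or> y 3 \<or> y 4 \<or> y 5 \<or> y 7"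
    "y 2 \<or> y 4 \<or> y 5 \<or> y 6 \<or> y 8" "y 3 \<or> y 5 \<or> y 6 \<or> y 7 \<or> y 9" "y 4 \<or> y 6 \<or> y 7 \<or> y 8 \<or> y 10"
    "y 0 \<or> y 3 \<or> y 5 \<or> y 8" "y 1 \<or> y 4 \<or> y 6 \<or> y 9" "y 2 \<or> y 5 \<or> y 7 \<or> y 10"
    "y 0 \<or> y 2 \<or> y 3 \<or> y 7 \<or> y 8 \<or> y 10"
  using assms by (auto simp: admissible_def dominated_def separated_def offsets_def)

text \<open>This is the shortest-path inequality for an edge whose weight is 3 x - 1 for the letter
  left behind, reduced by 2 if the edge enters the core. It involves eleven letters only, hence is a
  finite Boolean check.\<close>

lemma potA_step:
  assumes "admissible y"
  shows "potA y + (if \<not> core y \<and> core (\<lambda>j. y (j + 1)) then 2 else 0)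
         \<le> 3 * of_bool (y 0) - 1 + potA (\<lambda>j. y (j + 1))"
  using admissible_clauses[OF assms] unfolding potA_def core_def
  apply simp
  apply (smt (verit))
  done

text \<open>Away from the core each letter contributes at least 1/12 on average. Scaling the weights
  by 12 keeps the potential integral. Again only eleven letters matter.\<close>

lemma potB_step:
  assumes "admissible y" "\<not> core y" "\<not> core (\<lambda>j. y (j + 1))"
  shows "potB y + 1 \<le> 12 * (3 * of_bool (y 0) - 1) + potB (\<lambda>j. y (j + 1))"
  using admissible_clauses[OF assms(1)] assms(2,3) unfolding potB_def core_def
  apply simp
  apply (smt (verit))
  done

section \<open>Summing the potentials over one period\<close>

locale periodic_code =
  fixes x :: "int \<Rightarrow> bool" and n :: nat
  assumes large: "n \<ge> 13"
    and periodic: "x (i mod int n) = x i"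
    and dom: "dominated x i"
    and sep2: "separated x 2 i"
    and sep4: "separated x 4 i"
begin

definition window :: "int \<Rightarrow> int \<Rightarrow> bool" where
  "window i = (\<lambda>j. x (i + j))"

text \<open>The quantity W of the overview; it is 3|C| - n when \<open>x\<close> comes from a code
  C.\<close>

definition excess :: int where
  "excess = (\<Sum>i<n. 3 * of_bool (x (int i)) - 1)"

lemma window_shift: "(\<lambda>j. window i (j + 1)) = window (i + 1)"
  by (auto simp: window_def algebra_simps)

lemma window_0: "window i 0 = x i"
  by (simp add: window_def)

lemma window_mod: "window (i mod int n) = window i"
proof
  fix j
  have "x ((i mod int n + j) mod int n) = x ((i + j) mod int n)" by (simp add: mod_add_left_eq)
  then show "window (i mod int n) j = window i j" by (simp add: window_def periodic)
qed

lemma window_period: "window (i + m * int n) = window i"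
  using window_mod[of "i + m * int n"] window_mod[of i] by simp

lemma admissible_window: "admissible (window i)"
proof -
  have "dominated (window i) j" for j
    using dom[of "i + j"] by (simp add: dominated_def window_def algebra_simps)
  moreover have "separated (window i) 2 j" "separated (window i) 4 j" for j
    using sep2[of "i + j"] sep4[of "i + j"]
    by (simp_all add: separated_def window_def algebra_simps)
  ultimately show ?thesis by (simp add: admissible_def)
qed

text \<open>The windows form a closed walk of length n, so any potential cancels along it.\<close>

lemma telescope:
  fixes p :: "(int \<Rightarrow> bool) \<Rightarrow> int"
  shows "(\<Sum>i<n. p (window (int i + 1)) - p (window (int i))) = 0"
proof -
  have "(\<Sum>i<n. p (window (int i + 1)) - p (window (int i))) = p (window (int n)) - p (window 0)"
    using sum_lessThan_telescope[of "\<lambda>i. p (window (int i))" n] by (simp add: add.commute)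
  then show ?thesis using window_period[of 0 1] by simp
qed

lemma excess_ge_entries:
  "excess \<ge> (\<Sum>i<n. if \<not> core (window (int i)) \<and> core (window (int i + 1)) then 2 else 0)"
proof -
  have "(if \<not> core (window (int i)) \<and> core (window (int i + 1)) then 2 else 0) \<le>
      3 * of_bool (x (int i)) - 1 + (potA (window (int i + 1)) - potA (window (int i)))" for i
    using potA_step[OF admissible_window, of "int i"] by (simp only: window_shift window_0)
  then have "(\<Sum>i<n. if \<not> core (window (int i)) \<and> core (window (int i + 1)) then 2 else 0) \<le>
      (\<Sum>i<n. 3 * of_bool (x (int i)) - 1 + (potA (window (int i + 1)) - potA (window (int i))))"
    by (intro sum_mono)
  also have "\<dots> = excess"
    unfolding sum.distrib telescope excess_def by simp
  finally show ?thesis .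
qed

lemma excess_nonneg: "excess \<ge> 0"
  by (rule order_trans[OF _ excess_ge_entries]) (simp add: sum_nonneg)

lemma excess_without_core:
  assumes "\<And>i. \<not> core (window i)"
  shows "excess \<ge> 2"
proof -
  have "1 \<le> 12 * (3 * of_bool (x (int i)) - 1) +
      (potB (window (int i + 1)) - potB (window (int i)))" for i
    using potB_step[OF admissible_window, unfolded window_shift window_0, OF assms assms, of "int i"]
    by linarith
  then have "(\<Sum>i<n. 1) \<le> (\<Sum>i<n. 12 * (3 * of_bool (x (int i)) - 1) +
      (potB (window (int i + 1)) - potB (window (int i))))"
    by (intro sum_mono)
  also have "\<dots> = 12 * excess"
    unfolding sum.distrib telescope excess_def sum_distrib_left by simp
  \<comment> \<open>12 \<open>excess\<close> is at least n, hence at least 13, so the integer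
    \<open>excess\<close> exceeds 1.\<close>
  finally show ?thesis using large by simp
qed

text \<open>Without an entry into the core, everything to the right of \<open>l\<close> would stay
  outside it, yet the core window at \<open>k\<close> recurs in every period. A single entry already
  contributes 2.\<close>

lemma excess_mixed:
  assumes "core (window k)" "\<not> core (window l)"
  shows "excess \<ge> 2"
proof -
  have "\<exists>i. \<not> core (window i) \<and> core (window (i + 1))"
  proof (rule ccontr)
    assume no: "\<nexists>i. \<not> core (window i) \<and> core (window (i + 1))"
    have never: "\<not> core (window (l + int m))" for m
    proof (induction m)
      case (Suc m)
      then show ?case using no[simplified, rule_format, of "l + int m"] by (simp add: algebra_simps)
    qed (use assms(2) in simp)
    \<comment> \<open>As a period has length at least 1, moving \<open>k\<close> on by
      \<open>m\<close> periods passes \<open>l\<close>.\<close>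
    obtain m where m: "0 \<le> m" "l - k \<le> m" by (metis abs_ge_self abs_ge_zero)
    then have "m * 1 \<le> m * int n" using large by (intro mult_left_mono) auto
    then have "l \<le> k + m * int n" using m by linarith
    then have "\<not> core (window (k + m * int n))"
      using never[of "nat (k + m * int n - l)"] by simp
    then show False using assms(1) by (simp add: window_period)
  qed
  then obtain i where i: "\<not> core (window i)" "core (window (i + 1))" by blast
  \<comment> \<open>The entry is moved into 0, ..., n - 1, so that it is one of the
    summands.\<close>
  define r where "r = nat (i mod int n)"
  have r: "r < n" "int r = i mod int n" using large by (auto simp: r_def nat_less_iff)
  have "window (int r) = window i" by (simp add: r window_mod)
  moreover have "window (int r + 1) = window (i + 1)"
    using \<open>window (int r) = window i\<close> by (simp flip: window_shift)
  ultimately have e: "\<not> core (window (int r)) \<and> core (window (int r + 1))" using i by simp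
  have "2 \<le> (\<Sum>i<n. if \<not> core (window (int i)) \<and> core (window (int i + 1)) then 2 else (0::int))"
    using member_le_sum[of r "{..<n}"
      "\<lambda>i. if \<not> core (window (int i)) \<and> core (window (int i + 1)) then 2 else (0::int)"] r e
    by simp
  then show ?thesis using excess_ge_entries by linarith
qed

text \<open>Core windows are long enough to force period 6 locally, hence globally. Together with
  the period n this makes n mod 6 a period, and the block 110000 admits none of 1 to 5.\<close>

lemma all_core_imp_dvd:
  assumes "\<And>i. core (window i)"
  shows "6 dvd n"
proof -
  have step: "x (i + 6) = x i" for i
    using assms[of i] by (auto simp: core_def window_def)
  have step': "x (i + 6 * int m) = x i" for i m
  proof (induction m)
    case (Suc m)
    then show ?case using step[of "i + 6 * int m"] by (simp add: algebra_simps)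
  qed simp
  obtain i where i: "x i" "x (i + 1)"
    using assms[of 0] by (auto simp: core_def window_def)
  have i': "\<not> x (i + 2)" "\<not> x (i + 3)" "\<not> x (i + 4)" "\<not> x (i + 5)"
    using assms[of i] i by (auto simp: core_def window_def)
  have n: "int n = 6 * int (n div 6) + int (n mod 6)" by presburger
  have shift: "x (j + int (n mod 6)) = x j" for j
  proof -
    have "x (j + int n) = x (j + int (n mod 6))"
      using step'[of "j + int (n mod 6)" "n div 6"] by (subst n) (simp add: algebra_simps)
    moreover have "x (j + int n) = x j" using periodic[of "j + int n"] periodic[of j] by simp
    ultimately show ?thesis by simp
  qed
  have "n mod 6 = 0 \<or> n mod 6 = 1 \<or> n mod 6 = 2 \<or> n mod 6 = 3 \<or> n mod 6 = 4 \<or> n mod 6 = 5"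
    by presburger
  \<comment> \<open>A shift by 1 moves \<open>i + 1\<close>, and a shift by 2 to 5 moves
    \<open>i\<close>, onto one of the four zeros.\<close>
  then have "n mod 6 = 0"
    using shift[of i] shift[of "i + 1"] i i' by (elim disjE) (auto simp: ac_simps)
  then show ?thesis by auto
qed

lemma excess_dichotomy: "6 dvd n \<or> excess \<ge> 2"
  using all_core_imp_dvd excess_without_core excess_mixed by blast

end

lemma locating_dominating_card_ge:
  assumes "n \<ge> 13" "locating_dominating (circulant_verts n) (circulant_adj n {1, 3}) C"
  shows "3 * card C \<ge> n" "6 dvd n \<or> 3 * card C \<ge> n + 2"
proof -
  define x where "x = (\<lambda>i. i mod int n \<in> C)"
  have C: "C \<subseteq> circulant_verts n" "C \<noteq> {}"
    using assms(2) by (auto simp: locating_dominating_def)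
  interpret periodic_code x n
  proof
    fix i
    show "dominated x i" "separated x 2 i" "separated x 4 i"
      using locating_dominating_iff[OF assms(1) C] assms(2) by (auto simp: x_def)
  qed (use assms(1) in \<open>simp_all add: x_def\<close>)
  \<comment> \<open>Codewords are residues, so C is the set of true positions in one period and
    \<open>excess\<close> becomes 3|C| - n.\<close>
  have "card C = card (int ` {i. i < n \<and> x (int i)})"
  proof (rule arg_cong[of _ _ card], rule set_eqI)
    fix c
    show "c \<in> C \<longleftrightarrow> c \<in> int ` {i. i < n \<and> x (int i)}"
    proof
      assume "c \<in> C"
      then have "0 \<le> c" "c < int n" using C by (auto simp: circulant_verts_def)
      then show "c \<in> int ` {i. i < n \<and> x (int i)}"
        using \<open>c \<in> C\<close> by (intro image_eqI[of _ _ "nat c"]) (auto simp: x_def)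
    qed (auto simp: x_def)
  qed
  also have "\<dots> = card ({..<n} \<inter> {i. x (int i)})"
    by (subst card_image) (auto intro!: arg_cong[of _ _ card])
  finally have "excess = 3 * int (card C) - int n"
    by (simp add: excess_def sum_subtractf sum_of_bool_eq flip: sum_distrib_left)
  then show "3 * card C \<ge> n" "6 dvd n \<or> 3 * card C \<ge> n + 2"
    using excess_nonneg excess_dichotomy by linarith+
qed

subsection \<open>Upper bound\<close>

text \<open>The letters are the positions \<open>i - 3, \<dots>, i + 9\<close>; the conjuncts say that \<open>i\<close> is dominated
  and that it is separated from \<open>i + 2\<close>, \<open>i + 4\<close> and \<open>i + 6\<close>.\<close>

fun good_window :: "bool list \<Rightarrow> bool" where
  "good_window [a, b, c, d, e, f, g, h, i, j, k, l, m] \<longleftrightarrow>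
     (a \<or> c \<or> d \<or> e \<or> g) \<and> (a \<or> d \<or> f \<or> i) \<and> (a \<or> c \<or> d \<or> h \<or> i \<or> k) \<and>
     (a \<or> c \<or> d \<or> e \<or> i \<or> j \<or> k \<or> m)"
| "good_window _ \<longleftrightarrow> False"

text \<open>Doubling \<open>w\<close> turns the windows that wrap around into ordinary infixes,
  provided \<open>w\<close> has at least 13 letters.\<close>

definition cyclically_good :: "bool list \<Rightarrow> bool" where
  "cyclically_good w \<longleftrightarrow> (\<forall>r<length w. good_window (take 13 (drop r (w @ w))))"

lemma good_window_imp:
  assumes "good_window (map (\<lambda>j. x (i - 3 + int j)) [0..<13])" "d \<in> {2, 4, 6}"
  shows "dominated x i" "separated x d i"
proof -
  \<comment> \<open>\<open>good_window\<close> computes only on an explicit list of 13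
    letters.\<close>
  have "[0..<13] = [0, 1, 2, 3, 4, 5, 6, 7, 8, 9, 10, 11, 12]" by code_simp
  then have "good_window [x (i - 3), x (i - 2), x (i - 1), x i, x (i + 1), x (i + 2), x (i + 3),
      x (i + 4), x (i + 5), x (i + 6), x (i + 7), x (i + 8), x (i + 9)]"
    using assms(1) by (simp add: ac_simps del: good_window.simps)
  then have c: "x (i - 3) \<or> x (i - 1) \<or> x i \<or> x (i + 1) \<or> x (i + 3)"
    "x (i - 3) \<or> x i \<or> x (i + 2) \<or> x (i + 5)"
    "x (i - 3) \<or> x (i - 1) \<or> x i \<or> x (i + 4) \<or> x (i + 5) \<or> x (i + 7)"
    "x (i - 3) \<or> x (i - 1) \<or> x i \<or> x (i + 1) \<or> x (i + 5) \<or> x (i + 6) \<or> x (i + 7) \<or> x (i + 9)"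
    unfolding good_window.simps by argo+
  show "dominated x i" using c(1) by (elim disjE) (simp_all add: dominated_def offsets_def ac_simps)
  have "separated x 2 i" using c(2) by (elim disjE) (simp_all add: separated_def offsets_def ac_simps)
  moreover have "separated x 4 i" using c(3) by (elim disjE) (simp_all add: separated_def offsets_def ac_simps)
  moreover have "separated x 6 i" using c(4) by (elim disjE) (simp_all add: separated_def offsets_def ac_simps)
  ultimately show "separated x d i" using assms(2) by blast
qed

lemma cyclically_good_code:
  assumes "cyclically_good w" "length w \<ge> 13" "True \<in> set w"
  shows "\<exists>C. locating_dominating (circulant_verts (length w))
               (circulant_adj (length w) {1, 3}) C \<and> card C = length (filter id w)"
proof -
  define n where "n = length w"
  define C where "C = int ` {i. i < n \<and> w ! i}"
  define x where "x = (\<lambda>i. i mod int n \<in> C)"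
  have n: "n \<ge> 13" using assms(2) by (simp add: n_def)
  have x: "x (int i) \<longleftrightarrow> w ! (i mod n)" for i
    using n by (auto simp: x_def C_def simp flip: of_nat_mod)
  have sub: "C \<subseteq> circulant_verts n" by (auto simp: C_def circulant_verts_def)
  have ne: "C \<noteq> {}" using assms(3) by (auto simp: C_def n_def in_set_conv_nth)
  have good: "good_window (map (\<lambda>j. x (i - 3 + int j)) [0..<13])" for i
  proof -
    \<comment> \<open>The window belonging to \<open>i\<close> starts three letters before
      it.\<close>
    define r where "r = nat ((i - 3) mod int n)"
    have r: "r < n" "int r = (i - 3) mod int n" using n by (auto simp: r_def nat_less_iff)
    have "x (i - 3 + int j) = (w @ w) ! (r + j)" if "j < 13" for j
    proof -
      have "x (i - 3 + int j) = x (int (r + j))"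
        by (simp add: x_def r mod_add_left_eq)
      also have "\<dots> = w ! ((r + j) mod n)" by (rule x)
      also have "\<dots> = (w @ w) ! (r + j)"
        using r(1) that n by (auto simp: nth_append n_def mod_if)
      finally show ?thesis .
    qed
    then have "map (\<lambda>j. x (i - 3 + int j)) [0..<13] = take 13 (drop r (w @ w))"
      using r(1) n by (intro nth_equalityI) (auto simp: n_def simp del: take_append drop_append)
    then show ?thesis using assms(1) r(1) by (simp add: cyclically_good_def n_def)
  qed
  have "locating_dominating (circulant_verts n) (circulant_adj n {1, 3}) C"
    using locating_dominating_iff[OF n sub ne] good_window_imp[OF good] by (auto simp: x_def)
  moreover have "card C = length (filter id w)"
    unfolding C_def by (subst card_image) (auto simp: length_filter_conv_card n_def)
  ultimately show ?thesis unfolding n_def by blast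
qed

section \<open>Repeated periods followed by a tail\<close>

definition period :: "bool list" where
  "period = [True, True, False, False, False, False]"

definition periods :: "nat \<Rightarrow> bool list" where
  "periods m = concat (replicate m period)"

lemma length_periods: "length (periods m) = 6 * m"
  by (induction m) (auto simp: periods_def period_def)

lemma filter_periods: "length (filter id (periods m)) = 2 * m"
  by (induction m) (auto simp: periods_def period_def)

lemma periods_add: "periods (k + m) = periods k @ periods m"
  by (simp add: periods_def replicate_add)

text \<open>A window inside \<open>b\<close> sees neither \<open>a\<close> nor \<open>c\<close>, so
  a finite check of \<open>b\<close> carries over to longer words.\<close>

lemma good_window_infix:
  assumes "\<forall>k\<in>{..length b - 13}. good_window (take 13 (drop k b))"
    and "length a \<le> r" "r + 13 \<le> length a + length b"
  shows "good_window (take 13 (drop r (a @ b @ c)))"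
proof -
  have "take 13 (drop r (a @ b @ c)) = take 13 (drop (r - length a) b)"
    using assms(2,3) by simp
  then show ?thesis using assms by simp
qed

text \<open>Once \<open>m \<ge> 2\<close>, every cyclic window of 13 letters of \<open>periods m @ t\<close> already occurs in three
  periods or in \<open>periods 2 @ t @ periods 2\<close>, so a finite check settles all \<open>m\<close>.\<close>

definition extends_periods :: "bool list \<Rightarrow> bool" where
  "extends_periods t \<longleftrightarrow>
     (\<forall>k\<in>{..length t + 11}. good_window (take 13 (drop k (periods 2 @ t @ periods 2))))"

lemma cyclically_good_periods:
  assumes "m \<ge> 2" "extends_periods t"
  shows "cyclically_good (periods m @ t)"
  unfolding cyclically_good_def
proof (intro allI impI)
  fix r assume r: "r < length (periods m @ t)"
  obtain m' where m': "m = m' + 2" using assms(1) by (metis add.commute le_Suc_ex)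
  show "good_window (take 13 (drop r ((periods m @ t) @ periods m @ t)))"
  proof (cases "r < 6 * m'")
    case True
    \<comment> \<open>A window starting in period \<open>q\<close> ends within period
      \<open>q + 2\<close>, which still belongs to the first copy of \<open>periods m\<close>
      because q < m - 2.\<close>
    define q where "q = r div 6"
    have q: "q < m'" "6 * q \<le> r" "r < 6 * q + 6" using True by (auto simp: q_def)
    have "q + 3 \<le> m" using q m' by simp
    then obtain p where "m = q + (3 + p)" by (metis add.assoc le_Suc_ex)
    then have eq: "periods m = periods q @ periods 3 @ periods p"
      by (simp add: periods_add)
    have P: "\<forall>k\<in>{..length (periods 3) - 13}. good_window (take 13 (drop k (periods 3)))"
      by code_simp
    have "good_window (take 13 (drop r (periods q @ periods 3 @ (periods p @ t @ periods m @ t))))"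
      using q by (intro good_window_infix[OF P]) (auto simp: length_periods)
    moreover have "(periods m @ t) @ periods m @ t =
        periods q @ periods 3 @ (periods p @ t @ periods m @ t)"
      by (subst eq) simp
    ultimately show ?thesis by (simp only:)
  next
    case False
    \<comment> \<open>The remaining windows start in the last two periods or in \<open>t\<close> and
      end at most 12 letters after \<open>t\<close>, that is, within the first two periods of the
      second copy.\<close>
    have eq: "periods m = periods m' @ periods 2" "periods m = periods 2 @ periods m'"
      unfolding m' by (metis periods_add add.commute)+
    \<comment> \<open>The last possible start is 12 + \<open>length t\<close> + 12 - 13 =
      \<open>length t\<close> + 11.\<close>
    have "\<forall>k\<in>{..length (periods 2 @ t @ periods 2) - 13}.
        good_window (take 13 (drop k (periods 2 @ t @ periods 2)))"
      using assms(2) by (simp add: extends_periods_def length_periods)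
    then have "good_window (take 13 (drop r (periods m' @ (periods 2 @ t @ periods 2) @ (periods m' @ t))))"
      using False r m' by (intro good_window_infix) (auto simp: length_periods)
    moreover have "(periods m @ t) @ periods m @ t =
        periods m' @ (periods 2 @ t @ periods 2) @ (periods m' @ t)"
      by (subst eq(1), subst eq(2)) simp
    ultimately show ?thesis by (simp only:)
  qed
qed

lemma code_exists:
  assumes "m \<ge> 2" "n = 6 * m + length t" "extends_periods t" "n \<ge> 13"
  shows "\<exists>C. locating_dominating (circulant_verts n) (circulant_adj n {1, 3}) C \<and>
             card C = 2 * m + length (filter id t)"
proof -
  have "True \<in> set (periods m)"
    using assms(1) by (cases m) (auto simp: periods_def period_def)
  then show ?thesis
    using cyclically_good_code[OF cyclically_good_periods[OF assms(1,3)]] assms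
    by (simp add: length_periods filter_periods)
qed

text \<open>One tail for each residue modulo 6. Residue 1 takes length 7, since the tail
  \<open>[True]\<close> fails: the zero just before it and the first zero after the next 11 see the
  same two codewords.\<close>

lemma extends_periods_tails:
  "extends_periods []"
  "extends_periods [True, True, False, False, True, False, False]"
  "extends_periods [True, True]"
  "extends_periods [True, True, False]"
  "extends_periods [True, True, False, False]"
  "extends_periods [True, True, False, False, True]"
  by code_simp+

lemma optimal_code_exists:
  fixes n :: nat
  assumes "n \<ge> 13"
  shows "\<exists>C. locating_dominating (circulant_verts n) (circulant_adj n {1, 3}) C \<and>
             card C = (n + 2) div 3 + (if n mod 6 \<in> {0, 1, 4} then 0 else 1)"
proof -
  have code: ?thesis
    if "extends_periods t" "m \<ge> 2" "n = 6 * m + length t"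
      "(n + 2) div 3 + (if n mod 6 \<in> {0, 1, 4} then 0 else 1) = 2 * m + length (filter id t)" for m t
    using code_exists[OF that(2,3,1) assms] that(4) by simp
  define m where "m = n div 6"
  have m: "m \<ge> 2" using assms by (auto simp: m_def)
  have "n = 6 * m \<or> n = 6 * m + 1 \<or> n = 6 * m + 2 \<or> n = 6 * m + 3 \<or> n = 6 * m + 4 \<or> n = 6 * m + 5"
    unfolding m_def by presburger
  then consider "n = 6 * m" | "n = 6 * m + 1" | "n = 6 * m + 2" | "n = 6 * m + 3" | "n = 6 * m + 4"
    | "n = 6 * m + 5"
    by blast
  then show ?thesis
  proof cases
    case 1
    then show ?thesis by (intro code[OF extends_periods_tails(1) m]) simp_all
  next
    case 2
    show ?thesis
    \<comment> \<open>The tail of length 7 leaves only m - 1 periods. For n = 13 this is a single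
      one, too few for \<open>extends_periods\<close>, so that word is checked directly.\<close>
    proof (cases "m = 2")
      case True
      let ?w = "period @ [True, True, False, False, True, False, False]"
      have "cyclically_good ?w" by code_simp
      moreover have "length ?w = 13" "length (filter id ?w) = 5" "True \<in> set ?w"
        by (simp_all add: period_def)
      moreover have "n = 13" using True 2 by simp
      ultimately show ?thesis
        using cyclically_good_code[of ?w] by (simp only:) simp
    next
      case False
      with m obtain k where k: "m = Suc k" "k \<ge> 2" by (cases m) auto
      show ?thesis
        using 2 k by (intro code[OF extends_periods_tails(2) k(2)]) simp_all
    qed
  next
    case 3
    then show ?thesis by (intro code[OF extends_periods_tails(3) m]) (simp_all, presburger)
  next
    case 4
    then show ?thesis by (intro code[OF extends_periods_tails(4) m]) simp_all
  next
    case 5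
    then show ?thesis by (intro code[OF extends_periods_tails(5) m]) simp_all
  next
    case 6
    then show ?thesis by (intro code[OF extends_periods_tails(6) m]) simp_all
  qed
qed

section \<open>The exact value\<close>

lemma gamma_LD_circulant:
  fixes n :: nat
  assumes "n \<ge> 13"
  shows "gamma_LD (circulant_verts n) (circulant_adj n {1, 3}) =
         (n + 2) div 3 + (if n mod 6 \<in> {0, 1, 4} then 0 else 1)"
  unfolding gamma_LD_def
proof (rule Least_equality)
  show "\<exists>C. locating_dominating (circulant_verts n) (circulant_adj n {1, 3}) C \<and>
            card C = (n + 2) div 3 + (if n mod 6 \<in> {0, 1, 4} then 0 else 1)"
    using optimal_code_exists[OF assms] .
next
  fix k
  assume "\<exists>C. locating_dominating (circulant_verts n) (circulant_adj n {1, 3}) C \<and> card C = k"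
  then have "3 * k \<ge> n" "6 dvd n \<or> 3 * k \<ge> n + 2"
    using locating_dominating_card_ge[OF assms] by blast+
  then show "(n + 2) div 3 + (if n mod 6 \<in> {0, 1, 4} then 0 else 1) \<le> k"
    \<comment> \<open>For n mod 6 equal to 1 or 4, n + 2 is three times the ceiling of n/3. In the
      classes 2, 3 and 5 it exceeds that multiple of 3, which costs one more codeword.\<close>
    by (simp split: if_splits) presburger
qed

lemma ceiling_third: "\<lceil>real n / 3\<rceil> = int ((n + 2) div 3)"
proof (rule ceiling_unique)
  have "n \<le> 3 * ((n + 2) div 3)" "3 * ((n + 2) div 3) < n + 3" by presburger+
  then have "real n \<le> 3 * real ((n + 2) div 3)" "3 * real ((n + 2) div 3) < real n + 3"
    by linarith+
  then show "real_of_int (int ((n + 2) div 3)) - 1 < real n / 3"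
    "real n / 3 \<le> real_of_int (int ((n + 2) div 3))" by auto
qed

theorem theorem12:
  fixes n :: nat
  assumes "n \<ge> 13"
  shows "(n mod 6 \<in> {0, 1, 4} \<longrightarrow>
            int (gamma_LD (circulant_verts n) (circulant_adj n {1, 3})) = \<lceil>real n / 3\<rceil>) \<and>
         (n mod 6 \<notin> {0, 1, 4} \<longrightarrow>
            int (gamma_LD (circulant_verts n) (circulant_adj n {1, 3})) = \<lceil>real n / 3\<rceil> + 1)"
  by (simp add: gamma_LD_circulant[OF assms] ceiling_third)

end
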